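(* Let $w\in S_n$. A reduced pipe dream $D\in\mathrm{RPD}(w)$ is uniquely determined by its pipe dream tableau $\mathbf{T}(D)$; that is, if $D,D'\in\mathrm{RPD}(w)$ and $\mathbf{T}(D)=\mathbf{T}(D')$, then $D=D'$.
   Context: A pipe dream is a finite subset $D\subset \mathbb{Z}_{>0}\times\mathbb{Z}_{>0}$, in matrix coordinates ($(i,j)$ is row $i$ from the top, column $j$ from the left). Place a cross tile at each $(i,j)\in D$ (one strand joins the left and right edges, the other joins the top and bottom edges) and a bump tile at each $(i,j)\notin D$ (one strand joins the top edge to the left edge, the other joins the right edge to the bottom edge). The strands form pipes going from the top boundary to the left boundary; pipe $x$ is the one entering at the top of column $x$. The permutation $w$ of $D$ is defined by: $w(i)$ is the label of the pipe that exits the left boundary in row $i$. Permutations $w\in S_n$ are regarded as permutations of $\mathbb{Z}_{>0}$ fixing all $m>n$. $\mathrm{RPD}(w)$ is the set of reduced pipe dreams for $w$: pipe dreams $D$ whose permutation is $w$ and such that $|D|$ equals the number of inversions of $w$. Pipe dream tableau: $\mathrm{Inv}(w^{-1})=\{(x,y): x<y,\ w^{-1}(x)>w^{-1}(y)\}$. In any $D\in\mathrm{RPD}(w)$, pipes $x<y$ cross iff $(x,y)\in\mathrm{Inv}(w^{-1})$, in which case they cross exactly once, pipe $x$ passing vertically and pipe $y$ horizontally. A left bump of pipe $x$ is a bump tile in which pipe $x$ is the strand joining the top edge to the left edge. For $(x,y)\in\mathrm{Inv}(w^{-1})$ let $\mathbf{T}_D(x,y)$ be the number of left bumps of pipe $x$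 lying in rows strictly south of the crossing between pipes $x$ and $y$ in $D$. The pipe dream tableau $\mathbf{T}(D)$ is the filling of the Rothe diagram $\{(i,w(j)): i<j,\ w(i)>w(j)\}$ of $w$ with entry $\mathbf{T}_D(x,y)$ in cell $(w^{-1}(y),x)$. *)

theory Defs
  imports Complex_Main "HOL-Combinatorics.Permutations"
begin

definition pipe_dream :: "(nat \<times> nat) set \<Rightarrow> bool" where
  "pipe_dream D \<longleftrightarrow> finite D \<and> D \<subseteq> {1..} \<times> {1..}"

text \<open>
  Tile \<open>(i, j)\<close> has bottom edge \<open>Hor i j\<close> and right edge \<open>Ver i j\<close>; its top edge is therefore
  \<open>Hor (i - 1) j\<close> and its left edge \<open>Ver i (j - 1)\<close>. The edges \<open>Hor 0 j\<close> form the top boundary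
  and the edges \<open>Ver i 0\<close> the left boundary.
\<close>

datatype edge = Hor nat nat | Ver nat nat

definition top_edge :: "nat \<Rightarrow> nat \<Rightarrow> edge" where "top_edge i j = Hor (i - 1) j"
definition bottom_edge :: "nat \<Rightarrow> nat \<Rightarrow> edge" where "bottom_edge i j = Hor i j"
definition left_edge :: "nat \<Rightarrow> nat \<Rightarrow> edge" where "left_edge i j = Ver i (j - 1)"
definition right_edge :: "nat \<Rightarrow> nat \<Rightarrow> edge" where "right_edge i j = Ver i j"

text \<open>The strands of the tiles, oriented from the top boundary towards the left boundary.\<close>

inductive strand :: "(nat \<times> nat) set \<Rightarrow> edge \<Rightarrow> edge \<Rightarrow> bool" for D where
  cross_vertical:
    "\<lbrakk>1 \<le> i; 1 \<le> j; (i, j) \<in> D\<rbrakk> \<Longrightarrow> strand D (top_edge i j) (bottom_edge i j)"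
| cross_horizontal:
    "\<lbrakk>1 \<le> i; 1 \<le> j; (i, j) \<in> D\<rbrakk> \<Longrightarrow> strand D (right_edge i j) (left_edge i j)"
| bump_top_left:
    "\<lbrakk>1 \<le> i; 1 \<le> j; (i, j) \<notin> D\<rbrakk> \<Longrightarrow> strand D (top_edge i j) (left_edge i j)"
| bump_right_bottom:
    "\<lbrakk>1 \<le> i; 1 \<le> j; (i, j) \<notin> D\<rbrakk> \<Longrightarrow> strand D (right_edge i j) (bottom_edge i j)"

text \<open>\<open>on_pipe D x e\<close>: pipe \<open>x\<close>, entering at the top of column \<open>x\<close>, runs through the edge \<open>e\<close>.\<close>

definition on_pipe :: "(nat \<times> nat) set \<Rightarrow> nat \<Rightarrow> edge \<Rightarrow> bool" where
  "on_pipe D x e \<longleftrightarrow> 1 \<le> x \<and> (strand D)\<^sup>*\<^sup>* (top_edge 1 x) e"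

definition exits_in_row :: "(nat \<times> nat) set \<Rightarrow> nat \<Rightarrow> nat \<Rightarrow> bool" where
  "exits_in_row D x i \<longleftrightarrow> 1 \<le> i \<and> on_pipe D x (left_edge i 1)"

definition is_permutation_of :: "(nat \<Rightarrow> nat) \<Rightarrow> (nat \<times> nat) set \<Rightarrow> bool" where
  "is_permutation_of w D \<longleftrightarrow> (\<forall>i\<ge>1. exits_in_row D (w i) i)"

definition Inv :: "(nat \<Rightarrow> nat) \<Rightarrow> (nat \<times> nat) set" where
  "Inv w = {(x, y). 1 \<le> x \<and> x < y \<and> w x > w y}"

definition RPD :: "(nat \<Rightarrow> nat) \<Rightarrow> (nat \<times> nat) set set" where
  "RPD w = {D. pipe_dream D \<and> is_permutation_of w D \<and> card D = card (Inv w)}"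

definition crossing_at :: "(nat \<times> nat) set \<Rightarrow> nat \<Rightarrow> nat \<Rightarrow> nat \<times> nat \<Rightarrow> bool" where
  "crossing_at D x y = (\<lambda>(i, j). (i, j) \<in> D \<and>
     (on_pipe D x (top_edge i j) \<and> on_pipe D y (right_edge i j) \<or>
      on_pipe D y (top_edge i j) \<and> on_pipe D x (right_edge i j)))"

text \<open>Only meaningful for pipes that cross exactly once, as in a reduced pipe dream.\<close>

definition crossing :: "(nat \<times> nat) set \<Rightarrow> nat \<Rightarrow> nat \<Rightarrow> nat \<times> nat" where
  "crossing D x y = (THE c. crossing_at D x y c)"

definition left_bumps :: "(nat \<times> nat) set \<Rightarrow> nat \<Rightarrow> (nat \<times> nat) set" where
  "left_bumps D x =
     {(i, j). 1 \<le> i \<and> 1 \<le> j \<and> (i, j) \<notin> D \<and> on_pipe D x (top_edge i j)}"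

definition tableau_entry :: "(nat \<times> nat) set \<Rightarrow> nat \<Rightarrow> nat \<Rightarrow> nat" where
  "tableau_entry D x y = card {(i, j) \<in> left_bumps D x. i > fst (crossing D x y)}"

definition rothe_diagram :: "(nat \<Rightarrow> nat) \<Rightarrow> (nat \<times> nat) set" where
  "rothe_diagram w = {(i, w j) | i j. 1 \<le> i \<and> i < j \<and> w i > w j}"

text \<open>
  The pairs \<open>(x, y) \<in> Inv (inv w)\<close> correspond to the cells \<open>(inv w y, x)\<close> of the Rothe diagram;
  in terms of the cell \<open>(a, b)\<close> this is \<open>x = b\<close>, \<open>y = w a\<close>. The domain of the partial map is
  the Rothe diagram.
\<close>

definition pd_tableau :: "(nat \<Rightarrow> nat) \<Rightarrow> (nat \<times> nat) set \<Rightarrow> (nat \<times> nat) \<rightharpoonup> nat" where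
  "pd_tableau w D = (\<lambda>(a, b). Some (tableau_entry D b (w a))) |` rothe_diagram w"

end

theory Submission
  imports Defs
begin

text \<open>
  Every strand moves one antidiagonal down, and on an antidiagonal two pipes exchange their order
  only at a common cross. Hence every inversion is realised by a cross at which the smaller pipe
  is vertical; in a reduced pipe dream counting shows that these are all the crosses.

  If \<open>D \<noteq> D'\<close>, take the leftmost column in which they differ and in it the lowest differing tile,
  say a cross of pipes \<open>x\<close> (vertical) and \<open>y\<close> in \<open>D'\<close> and a bump in \<open>D\<close>. The remaining ways from
  this tile are the same in \<open>D\<close> and \<open>D'\<close>, so in \<open>D\<close> the pipes \<open>x\<close> and \<open>y\<close> must have crossed before.
  From that crossing, \<open>x\<close> departs downwards but it arrives at the bump tile from the right: it makes
  an additional left bump, so the entry at \<open>(x, y)\<close> is larger for \<open>D\<close> than for \<open>D'\<close>.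
\<close>

section \<open>Strands as a partial injection on edges\<close>

lemma rtranclp_comparable:
  assumes det: "\<forall>a b c. r a b \<longrightarrow> r a c \<longrightarrow> b = c" and "r\<^sup>*\<^sup>* a b" "r\<^sup>*\<^sup>* a c"
  shows "r\<^sup>*\<^sup>* b c \<or> r\<^sup>*\<^sup>* c b"
  using assms(2,3)
proof (induction rule: rtranclp_induct)
  case base
  then show ?case by simp
next
  case (step u v)
  show ?case
  proof (cases "r\<^sup>*\<^sup>* c u")
    case True
    then show ?thesis using rtranclp.rtrancl_into_rtrancl[OF True step.hyps(2)] by simp
  next
    case False
    then have "r\<^sup>*\<^sup>* u c" "u \<noteq> c" using step.IH step.prems by auto
    then obtain v' where "r u v'" "r\<^sup>*\<^sup>* v' c" by (metis converse_rtranclpE)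
    moreover have "v = v'" using det step.hyps(2) \<open>r u v'\<close> by simp
    ultimately show ?thesis by simp
  qed
qed

lemma rtranclp_comparable_converse:
  assumes "\<forall>a b c. r b a \<longrightarrow> r c a \<longrightarrow> b = c" "r\<^sup>*\<^sup>* b a" "r\<^sup>*\<^sup>* c a"
  shows "r\<^sup>*\<^sup>* b c \<or> r\<^sup>*\<^sup>* c b"
  using rtranclp_comparable[of "r\<inverse>\<inverse>" a b c] assms by (auto simp: rtranclp_conversep)

text \<open>\<open>Hor i j\<close> is the top edge of tile \<open>(Suc i, j)\<close>, and below
  \<open>Ver i j\<close> is the right edge of tile \<open>(i, j)\<close>. Naming the tile that an
  edge enters makes its successor explicit, so that strands can be followed by rewriting.\<close>

lemma strand_Hor_iff:
  "strand D (Hor i j) e \<longleftrightarrow>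
     1 \<le> j \<and> e = (if (Suc i, j) \<in> D then Hor (Suc i) j else Ver (Suc i) (j - 1))"
proof
  show "strand D (Hor i j) e \<Longrightarrow>
     1 \<le> j \<and> e = (if (Suc i, j) \<in> D then Hor (Suc i) j else Ver (Suc i) (j - 1))"
    by (erule strand.cases)
      (auto simp: top_edge_def bottom_edge_def left_edge_def right_edge_def)
  show "1 \<le> j \<and> e = (if (Suc i, j) \<in> D then Hor (Suc i) j else Ver (Suc i) (j - 1)) \<Longrightarrow>
     strand D (Hor i j) e"
    using strand.cross_vertical[of "Suc i" j D] strand.bump_top_left[of "Suc i" j D]
    by (auto simp: top_edge_def bottom_edge_def left_edge_def split: if_splits)
qed

lemma strand_Ver_iff:
  "strand D (Ver i j) e \<longleftrightarrow>
     1 \<le> i \<and> 1 \<le> j \<and> e = (if (i, j) \<in> D then Ver i (j - 1) else Hor i j)"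
proof
  show "strand D (Ver i j) e \<Longrightarrow>
     1 \<le> i \<and> 1 \<le> j \<and> e = (if (i, j) \<in> D then Ver i (j - 1) else Hor i j)"
    by (erule strand.cases)
      (auto simp: top_edge_def bottom_edge_def left_edge_def right_edge_def)
  show "1 \<le> i \<and> 1 \<le> j \<and> e = (if (i, j) \<in> D then Ver i (j - 1) else Hor i j) \<Longrightarrow>
     strand D (Ver i j) e"
    using strand.cross_horizontal[of i j D] strand.bump_right_bottom[of i j D]
    by (auto simp: right_edge_def bottom_edge_def left_edge_def split: if_splits)
qed

lemmas strand_iff = strand_Hor_iff strand_Ver_iff

lemma strand_right_unique: "strand D e f \<Longrightarrow> strand D e g \<Longrightarrow> f = g"
  by (cases e) (auto simp: strand_iff)

lemma strand_left_unique: "strand D e g \<Longrightarrow> strand D f g \<Longrightarrow> e = f"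
  by (cases e; cases f) (auto simp: strand_iff eq_diff_iff split: if_splits)

lemma reach_linear:
  "(strand D)\<^sup>*\<^sup>* e f \<Longrightarrow> (strand D)\<^sup>*\<^sup>* e g \<Longrightarrow> (strand D)\<^sup>*\<^sup>* f g \<or> (strand D)\<^sup>*\<^sup>* g f"
  by (rule rtranclp_comparable) (use strand_right_unique in blast)+

lemma reach_linear_converse:
  "(strand D)\<^sup>*\<^sup>* f e \<Longrightarrow> (strand D)\<^sup>*\<^sup>* g e \<Longrightarrow> (strand D)\<^sup>*\<^sup>* f g \<or> (strand D)\<^sup>*\<^sup>* g f"
  by (rule rtranclp_comparable_converse) (use strand_left_unique in blast)+

text \<open>The number of the antidiagonal (column minus row) of the midpoint of an edge, up to a shift.\<close>

fun level :: "edge \<Rightarrow> int" where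
  "level (Hor i j) = int j - int i"
| "level (Ver i j) = int j - int i + 1"

text \<open>The place of an edge on its antidiagonal, counted from the northwest.\<close>

fun pos :: "edge \<Rightarrow> int" where
  "pos (Hor i j) = 2 * int i"
| "pos (Ver i j) = 2 * int i - 1"

fun valid_edge :: "edge \<Rightarrow> bool" where
  "valid_edge (Hor i j) \<longleftrightarrow> 1 \<le> j"
| "valid_edge (Ver i j) \<longleftrightarrow> 1 \<le> i"

fun row :: "edge \<Rightarrow> nat" where
  "row (Hor i j) = i"
| "row (Ver i j) = i"

fun col :: "edge \<Rightarrow> nat" where
  "col (Hor i j) = j"
| "col (Ver i j) = j"

section \<open>Monotone quantities along strands\<close>

lemma level_strand: "strand D e f \<Longrightarrow> level e = level f + 1"
  by (cases e) (auto simp: strand_iff)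

lemma row_strand: "strand D e f \<Longrightarrow> row e \<le> row f"
  by (cases e) (auto simp: strand_iff)

lemma col_strand: "strand D e f \<Longrightarrow> col f \<le> col e"
  by (cases e) (auto simp: strand_iff)

lemma valid_edge_strand: "strand D e f \<Longrightarrow> valid_edge f"
  by (cases e) (auto simp: strand_iff)

lemma level_reach: "(strand D)\<^sup>*\<^sup>* e f \<Longrightarrow> level f \<le> level e"
  by (induction rule: rtranclp_induct) (auto dest: level_strand)

lemma row_reach: "(strand D)\<^sup>*\<^sup>* e f \<Longrightarrow> row e \<le> row f"
  by (induction rule: rtranclp_induct) (auto dest: row_strand)

lemma col_reach: "(strand D)\<^sup>*\<^sup>* e f \<Longrightarrow> col f \<le> col e"
  by (induction rule: rtranclp_induct) (auto dest: col_strand)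

lemma reach_eq_of_level:
  assumes "(strand D)\<^sup>*\<^sup>* e f" "level e \<le> level f"
  shows "e = f"
  using assms by (metis converse_rtranclpE level_reach level_strand zle_add1_eq_le linorder_not_le)

text \<open>Levels fall by exactly one per strand, so no value is skipped.\<close>

lemma reach_level_between:
  assumes "(strand D)\<^sup>*\<^sup>* e f" "level f \<le> d" "d \<le> level e"
  shows "\<exists>g. (strand D)\<^sup>*\<^sup>* e g \<and> level g = d"
  using assms
proof (induction rule: rtranclp_induct)
  case base
  then show ?case by auto
next
  case (step u v)
  show ?case
  proof (cases "level u \<le> d")
    case True
    then show ?thesis using step by blast
  next
    case False
    then have "level v = d" using step level_strand by fastforce
    then show ?thesis using rtranclp.rtrancl_into_rtrancl[OF step.hyps] by blast
  qed
qed

lemma no_strand_to_top: "\<not> strand D e (Hor 0 j)"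
  by (cases e) (auto simp: strand_iff)

lemma no_strand_from_left: "\<not> strand D (Ver i 0) e"
  by (auto simp: strand_iff)

lemma reach_top_eq: "(strand D)\<^sup>*\<^sup>* e (Hor 0 j) \<Longrightarrow> e = Hor 0 j"
  by (erule rtranclp.cases) (auto simp: no_strand_to_top)

lemma reach_from_left_eq: "(strand D)\<^sup>*\<^sup>* (Ver i 0) e \<Longrightarrow> e = Ver i 0"
  by (erule converse_rtranclpE) (auto simp: no_strand_from_left)

section \<open>Pipes as paths from the top boundary\<close>

lemma on_pipe_iff: "on_pipe D x e \<longleftrightarrow> 1 \<le> x \<and> (strand D)\<^sup>*\<^sup>* (Hor 0 x) e"
  by (simp add: on_pipe_def top_edge_def)

lemma on_pipe_reach: "on_pipe D x e \<Longrightarrow> (strand D)\<^sup>*\<^sup>* e f \<Longrightarrow> on_pipe D x f"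
  by (auto simp: on_pipe_iff)

lemma on_pipe_strand: "on_pipe D x e \<Longrightarrow> strand D e f \<Longrightarrow> on_pipe D x f"
  by (auto simp: on_pipe_iff)

text \<open>Predecessors are unique and the entry edge of a pipe has none, so walking back cannot
  leave the pipe.\<close>

lemma on_pipe_reach_back:
  assumes "on_pipe D x f" "(strand D)\<^sup>*\<^sup>* e f"
  shows "on_pipe D x e"
  using assms reach_linear_converse[of D "Hor 0 x" f e] reach_top_eq
  by (auto simp: on_pipe_iff)

lemma on_pipe_linear:
  "on_pipe D x e \<Longrightarrow> on_pipe D x f \<Longrightarrow> (strand D)\<^sup>*\<^sup>* e f \<or> (strand D)\<^sup>*\<^sup>* f e"
  using reach_linear by (auto simp: on_pipe_iff)

lemma on_pipe_unique:
  assumes "on_pipe D x e" "on_pipe D y e"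
  shows "x = y"
  using assms reach_linear_converse[of D "Hor 0 x" e "Hor 0 y"] reach_top_eq
  by (auto simp: on_pipe_iff dest: reach_top_eq)

lemma on_pipe_valid: "on_pipe D x e \<Longrightarrow> valid_edge e"
  unfolding on_pipe_iff by (elim conjE, erule rtranclp.cases) (auto dest: valid_edge_strand)

lemma on_pipe_level_le: "on_pipe D x e \<Longrightarrow> level e \<le> level f \<Longrightarrow> on_pipe D x f
    \<Longrightarrow> (strand D)\<^sup>*\<^sup>* f e"
  using on_pipe_linear reach_eq_of_level by blast

lemma on_pipe_predecessor:
  assumes "on_pipe D x f" "level f < int x"
  obtains e where "on_pipe D x e" "strand D e f"
proof -
  have "f \<noteq> Hor 0 x" using assms(2) by auto
  then show ?thesis
    using assms(1) that unfolding on_pipe_iff by (metis rtranclp.cases)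
qed

lemma on_pipe_exit:
  assumes "is_permutation_of w D" "1 \<le> i"
  shows "on_pipe D (w i) (Ver i 0)"
  using assms by (auto simp: is_permutation_of_def exits_in_row_def left_edge_def)

section \<open>Inversions force crossings\<close>

text \<open>The strands of a tile in row r start at positions 2r-2 (top) and 2r-1 (right) and end at
  2r-1 (left) and 2r (bottom). A bump keeps their order and a cross swaps it; different tiles on an
  antidiagonal use disjoint pairs of positions.\<close>

lemma pos_less_strand:
  assumes e: "strand D e f" and e': "strand D e' f'" and lev: "level e = level e'"
    and less: "pos e < pos e'"
    and no_cross: "\<And>i j. (Suc i, j) \<in> D \<Longrightarrow> e = Hor i j \<Longrightarrow> e' \<noteq> Ver (Suc i) j"
  shows "pos f < pos f'"
proof (cases e)
  case (Hor i j)
  show ?thesis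
  proof (cases e')
    case (Hor i' j')
    then show ?thesis using \<open>e = Hor i j\<close> e e' less by (auto simp: strand_iff split: if_splits)
  next
    case (Ver i' j')
    show ?thesis
    proof (cases "i' = Suc i")
      case True
      then have "j' = j" using lev Hor Ver by auto
      then show ?thesis using no_cross[of i j] True Hor Ver e e'
        by (auto simp: strand_iff split: if_splits)
    next
      case False
      then show ?thesis using Hor Ver e e' less by (auto simp: strand_iff split: if_splits)
    qed
  qed
next
  case (Ver i j)
  then show ?thesis using e e' less by (cases e') (auto simp: strand_iff split: if_splits)
qed

text \<open>Pipe \<open>w b\<close> starts northwest of pipe \<open>w a\<close>. Without a crossing
  it stays so until \<open>w a\<close> exits in row \<open>a\<close>; but no edge of the quadrant
  lies northwest of a left boundary edge on its antidiagonal, although \<open>w b\<close> has yet to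
  exit further down.\<close>

lemma inversion_crossing:
  assumes w: "is_permutation_of w D" and ab: "(a, b) \<in> Inv w"
  shows "\<exists>i j. (Suc i, j) \<in> D \<and> on_pipe D (w b) (Hor i j) \<and> on_pipe D (w a) (Ver (Suc i) j)"
proof (rule ccontr)
  assume no_cross: "\<not> ?thesis"
  have ab: "1 \<le> a" "a < b" "w b < w a" using ab by (auto simp: Inv_def)
  have exit_x: "on_pipe D (w b) (Ver b 0)" and exit_y: "on_pipe D (w a) (Ver a 0)"
    using on_pipe_exit[OF w] ab by auto
  have order: "pos e < pos e'"
    if "(strand D)\<^sup>*\<^sup>* (Hor 0 (w b)) e" "on_pipe D (w a) e'" "level e' = level e" for e e'
    using that
  proof (induction arbitrary: e' rule: rtranclp_induct)
    case base
    show ?case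
    proof (cases e')
      case (Hor i j)
      have "i \<noteq> 0"
      proof
        assume "i = 0"
        then show False
          using Hor base ab reach_top_eq[of D "Hor 0 (w a)" j] by (simp add: on_pipe_iff)
      qed
      then show ?thesis using Hor by simp
    next
      case (Ver i j)
      then show ?thesis using on_pipe_valid[OF base(1)] by simp
    qed
  next
    case (step e f)
    \<comment> \<open>Pipe \<open>w a\<close> enters at the higher level \<open>w a\<close>, so at
      the level of \<open>f\<close> it already has a preceding edge.\<close>
    have "level f \<le> int (w b)"
      using step.hyps level_reach[of D "Hor 0 (w b)" f] by (simp add: rtranclp.rtrancl_into_rtrancl)
    then obtain f' where f': "on_pipe D (w a) f'" "strand D f' e'"
      using on_pipe_predecessor[OF step.prems(1)] ab step.prems(2) by auto
    have lev: "level f' = level e"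
      using level_strand[OF f'(2)] level_strand[OF step.hyps(2)] step.prems(2) by simp
    have "on_pipe D (w b) e" using step.hyps(1) exit_x by (auto simp: on_pipe_iff)
    then show ?case
      using pos_less_strand[OF step.hyps(2) f'(2) lev[symmetric] step.IH[OF f'(1) lev]]
        no_cross f'(1) by blast
  qed
  \<comment> \<open>\<open>1 - int a\<close> is the level of the exit edge
    \<open>Ver a 0\<close>.\<close>
  obtain g where g: "(strand D)\<^sup>*\<^sup>* (Hor 0 (w b)) g" "level g = 1 - int a"
    using reach_level_between[of D "Hor 0 (w b)" "Ver b 0" "1 - int a"] exit_x ab
    by (auto simp: on_pipe_iff)
  have "valid_edge g" using g(1) exit_x on_pipe_valid by (auto simp: on_pipe_iff)
  moreover have "pos g < 2 * int a - 1" using order[OF g(1) exit_y] g(2) by simp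
  ultimately show False using g(2) by (cases g) auto
qed

section \<open>Crosses of a reduced pipe dream correspond to inversions\<close>

text \<open>A cross determines its two pipes, so choosing a cross for every inversion is injective;
  as the two finite sets have the same size, no cross is left over.\<close>

lemma reduced_cross:
  assumes inj: "inj w" and D: "D \<in> RPD w" and c: "(i, j) \<in> D"
  shows "\<exists>a b. (a, b) \<in> Inv w \<and> on_pipe D (w b) (Hor (i - 1) j) \<and> on_pipe D (w a) (Ver i j)"
proof -
  define P where "P = (\<lambda>p c. c \<in> D \<and> on_pipe D (w (snd p)) (Hor (fst c - 1) (snd c)) \<and>
    on_pipe D (w (fst p)) (Ver (fst c) (snd c)))"
  have D': "finite D" "is_permutation_of w D" "card D = card (Inv w)"
    using D by (auto simp: RPD_def pipe_dream_def)
  have "\<exists>c. P p c" if p: "p \<in> Inv w" for p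
  proof -
    obtain a b where ab: "p = (a, b)" by fastforce
    then obtain i j where "(Suc i, j) \<in> D" "on_pipe D (w b) (Hor i j)"
        "on_pipe D (w a) (Ver (Suc i) j)"
      using inversion_crossing[OF D'(2)] p by blast
    then have "P p (Suc i, j)" by (simp add: P_def ab)
    then show ?thesis by blast
  qed
  then obtain f where f: "P p (f p)" if "p \<in> Inv w" for p by metis
  have "inj_on f (Inv w)"
  proof (rule inj_onI)
    fix p q assume pq: "p \<in> Inv w" "q \<in> Inv w" "f p = f q"
    then have "P p (f p)" "P q (f p)" using f[of p] f[of q] by auto
    then have "w (fst p) = w (fst q)" "w (snd p) = w (snd q)"
      unfolding P_def using on_pipe_unique by blast+
    then show "p = q" using inj by (auto simp: prod_eq_iff dest: injD)
  qed
  moreover have "f ` Inv w \<subseteq> D" using f by (auto simp: P_def)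
  ultimately have "f ` Inv w = D"
    using D' by (metis card_image card_subset_eq)
  then obtain p where p: "p \<in> Inv w" "f p = (i, j)" using c by (metis imageE)
  then have "P p (i, j)" using f[of p] by simp
  then show ?thesis using p(1) unfolding P_def by (cases p) auto
qed

text \<open>\<open>crossing_at\<close> is symmetric in the two pipes; \<open>reduced_cross\<close>
  rules out the orientation in which the larger pipe is vertical.\<close>

lemma crossing_at_reduced:
  assumes inj: "inj w" and D: "D \<in> RPD w" and ab: "(a, b) \<in> Inv w"
    and cr: "crossing_at D (w b) (w a) (i, j)"
  shows "on_pipe D (w b) (Hor (i - 1) j)" "on_pipe D (w a) (Ver i j)"
proof -
  have c: "(i, j) \<in> D" using cr by (simp add: crossing_at_def)
  obtain a' b' where ab': "(a', b') \<in> Inv w" "on_pipe D (w b') (Hor (i - 1) j)"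
      "on_pipe D (w a') (Ver i j)"
    using reduced_cross[OF inj D c] by blast
  have "w b < w a" "w b' < w a'" using ab ab'(1) by (auto simp: Inv_def)
  moreover have "w b = w b' \<and> w a = w a' \<or> w a = w b' \<and> w b = w a'"
    using cr on_pipe_unique[OF ab'(2)] on_pipe_unique[OF ab'(3)]
    by (auto simp: crossing_at_def top_edge_def right_edge_def)
  ultimately have "w b = w b' \<and> w a = w a'" by auto
  then show "on_pipe D (w b) (Hor (i - 1) j)" "on_pipe D (w a) (Ver i j)" using ab' by auto
qed

lemma crossing_at_exists:
  assumes "D \<in> RPD w" "(a, b) \<in> Inv w"
  shows "\<exists>c. crossing_at D (w b) (w a) c"
proof -
  obtain i j where "(Suc i, j) \<in> D" "on_pipe D (w b) (Hor i j)" "on_pipe D (w a) (Ver (Suc i) j)"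
    using inversion_crossing[of w D a b] assms by (auto simp: RPD_def)
  then have "crossing_at D (w b) (w a) (Suc i, j)"
    by (simp add: crossing_at_def top_edge_def right_edge_def)
  then show ?thesis by blast
qed

text \<open>Double counting of the pairs \<open>S\<close> of an inversion and a crossing of it:
  \<open>snd\<close> injects \<open>S\<close> into \<open>D\<close>, while \<open>fst\<close> maps
  \<open>S\<close> onto the equally large \<open>Inv w\<close>, so \<open>fst\<close> is injective
  too.\<close>

lemma crossing_at_unique:
  assumes inj: "inj w" and D: "D \<in> RPD w" and ab: "(a, b) \<in> Inv w"
    and "crossing_at D (w b) (w a) c" "crossing_at D (w b) (w a) c'"
  shows "c = c'"
proof -
  define S where "S = {(p, c). p \<in> Inv w \<and> crossing_at D (w (snd p)) (w (fst p)) c}"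
  have fin: "finite D" and card: "card D = card (Inv w)"
    using D by (auto simp: RPD_def pipe_dream_def)
  have "inj_on snd S"
  proof (rule inj_onI, clarsimp simp: S_def)
    fix a b a' b' i j
    assume A: "(a, b) \<in> Inv w" "crossing_at D (w b) (w a) (i, j)"
      "(a', b') \<in> Inv w" "crossing_at D (w b') (w a') (i, j)"
    show "a = a' \<and> b = b'"
      using crossing_at_reduced[OF inj D A(1,2)] crossing_at_reduced[OF inj D A(3,4)]
        on_pipe_unique injD[OF inj] by metis
  qed
  moreover have "snd ` S \<subseteq> D" by (auto simp: S_def crossing_at_def)
  ultimately have S: "finite S" "card S \<le> card (Inv w)"
    using fin card by (auto intro: inj_on_finite card_inj_on_le simp flip: card)
  have "fst ` S = Inv w" using crossing_at_exists[OF D] by (force simp: S_def image_iff)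
  then have "inj_on fst S"
    using S by (metis card_image_le eq_card_imp_inj_on le_antisym)
  then have "((a, b), c) = ((a, b), c')"
    by (rule inj_onD) (use assms in \<open>auto simp: S_def\<close>)
  then show ?thesis by simp
qed

lemma crossing_eq:
  assumes "inj w" "D \<in> RPD w" "(a, b) \<in> Inv w" "crossing_at D (w b) (w a) c"
  shows "crossing D (w b) (w a) = c"
  unfolding crossing_def using crossing_at_unique[OF assms(1-3)] assms(4) by blast

section \<open>Left bumps and the comparison of two pipe dreams\<close>

text \<open>Needed because a strict inclusion gives a strict inequality of \<open>card\<close> only
  for finite sets. The bound is \<open>Suc b\<close>, since the top edge of a tile carries the index
  of the row above.\<close>

lemma finite_left_bumps:
  assumes "is_permutation_of w D" "1 \<le> b"
  shows "finite (left_bumps D (w b))"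
proof (rule finite_subset)
  show "left_bumps D (w b) \<subseteq> {..Suc b} \<times> {..w b}"
  proof (clarsimp simp: left_bumps_def top_edge_def)
    fix i j assume "on_pipe D (w b) (Hor (i - Suc 0) j)"
    moreover from this have "(strand D)\<^sup>*\<^sup>* (Hor (i - Suc 0) j) (Ver b 0)"
      using on_pipe_linear[OF _ on_pipe_exit[OF assms]] reach_from_left_eq by fastforce
    ultimately show "i \<le> Suc b \<and> j \<le> w b"
      using row_reach[of D "Hor (i - Suc 0) j" "Ver b 0"]
        col_reach[of D "Hor 0 (w b)" "Hor (i - Suc 0) j"] by (auto simp: on_pipe_iff)
  qed
qed simp

text \<open>Only a bump turns a downward strand to the left; going back from the vertical edge
  through crosses and bumps, the last such turn is found.\<close>

lemma reach_Hor_Ver_left_bump: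
  assumes "(strand D)\<^sup>*\<^sup>* (Hor i j) (Ver k l)"
  shows "\<exists>i' j'. i < i' \<and> i' \<le> k \<and> 1 \<le> j' \<and> (i', j') \<notin> D \<and>
    (strand D)\<^sup>*\<^sup>* (Hor i j) (Hor (i' - 1) j')"
  using assms
proof (induction "Ver k l" arbitrary: k l rule: rtranclp_induct)
  case (step e)
  show ?case
  proof (cases e)
    case (Hor i' j')
    then show ?thesis using step.hyps row_reach[OF step.hyps(1)]
      by (intro exI[of _ "Suc i'"] exI[of _ j']) (auto simp: strand_iff split: if_splits)
  next
    case (Ver i' j')
    then show ?thesis using step.hyps by (auto simp: strand_iff split: if_splits)
  qed
qed

text \<open>The edges that can be met after leaving the tile \<open>(k, l)\<close>.\<close>

fun after_tile :: "nat \<Rightarrow> nat \<Rightarrow> edge \<Rightarrow> bool" where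
  "after_tile k l (Hor i j) \<longleftrightarrow> j < l \<or> j = l \<and> k \<le> i"
| "after_tile k l (Ver i j) \<longleftrightarrow> j < l \<or> j = l \<and> k < i"

text \<open>An edge satisfying \<open>after_tile k l\<close> enters a tile where \<open>D\<close>
  and \<open>D'\<close> agree, and that tile's outgoing edges satisfy it again.\<close>

lemma reach_after_tile:
  assumes agree: "\<forall>i j. j < l \<or> j = l \<and> k < i \<longrightarrow> ((i, j) \<in> D \<longleftrightarrow> (i, j) \<in> D')"
    and "(strand D)\<^sup>*\<^sup>* e f" "after_tile k l e"
  shows "(strand D')\<^sup>*\<^sup>* e f \<and> after_tile k l f"
  using assms(2,3)
proof (induction rule: rtranclp_induct)
  case base
  then show ?case by simp
next
  case (step f g)
  have "strand D' f g \<and> after_tile k l g"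
    using step agree by (cases f) (auto simp: strand_iff split: if_splits)
  then show ?case using step.IH assms(3) by (auto intro: rtranclp.rtrancl_into_rtrancl)
qed

text \<open>The exit row transfers the label: the common remainder of the path ends in row
  \<open>a\<close>, where both pipe dreams have pipe \<open>w a\<close>.\<close>

lemma on_pipe_after_tile:
  assumes agree: "\<forall>i j. j < l \<or> j = l \<and> k < i \<longrightarrow> ((i, j) \<in> D \<longleftrightarrow> (i, j) \<in> D')"
    and w: "is_permutation_of w D" "is_permutation_of w D'" "1 \<le> a"
    and e: "on_pipe D (w a) e" "after_tile k l e"
  shows "on_pipe D' (w a) e"
proof -
  have "(strand D)\<^sup>*\<^sup>* e (Ver a 0)"
    using on_pipe_linear[OF e(1) on_pipe_exit[OF w(1,3)]] reach_from_left_eq by fastforce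
  then show ?thesis
    using reach_after_tile[OF agree] e(2) on_pipe_reach_back[OF on_pipe_exit[OF w(2,3)]] by blast
qed

lemma tableau_entry_less:
  assumes inj: "inj w" and D: "D \<in> RPD w" and D': "D' \<in> RPD w"
    and kl: "(k, l) \<in> D'" "(k, l) \<notin> D"
    and agree: "\<forall>i j. j < l \<or> j = l \<and> k < i \<longrightarrow> ((i, j) \<in> D \<longleftrightarrow> (i, j) \<in> D')"
  shows "\<exists>a b. (a, b) \<in> Inv w \<and> tableau_entry D' (w b) (w a) < tableau_entry D (w b) (w a)"
proof -
  have agree': "\<forall>i j. j < l \<or> j = l \<and> k < i \<longrightarrow> ((i, j) \<in> D' \<longleftrightarrow> (i, j) \<in> D)"
    using agree by blast
  have perm: "is_permutation_of w D" "is_permutation_of w D'" using D D' by (auto simp: RPD_def)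
  have pos: "1 \<le> k" "1 \<le> l" using D' kl by (auto simp: RPD_def pipe_dream_def)
  obtain a b where ab: "(a, b) \<in> Inv w" and x': "on_pipe D' (w b) (Hor (k - 1) l)"
      and y': "on_pipe D' (w a) (Ver k l)"
    using reduced_cross[OF inj D' kl(1)] by blast
  have ab1: "1 \<le> a" "1 \<le> b" using ab by (auto simp: Inv_def)
  have cr': "crossing_at D' (w b) (w a) (k, l)"
    using x' y' kl by (simp add: crossing_at_def top_edge_def right_edge_def)
  have x'2: "on_pipe D' (w b) (Hor k l)"
    using on_pipe_strand[OF x', of "Hor k l"] kl pos by (simp add: strand_iff)
  have y'2: "on_pipe D' (w a) (Ver k (l - 1))"
    using on_pipe_strand[OF y', of "Ver k (l - 1)"] kl pos by (simp add: strand_iff)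
  have x2: "on_pipe D (w b) (Hor k l)"
    using on_pipe_after_tile[OF agree' perm(2,1) ab1(2) x'2] by simp
  have y2: "on_pipe D (w a) (Ver k (l - 1))"
    using on_pipe_after_tile[OF agree' perm(2,1) ab1(1) y'2] pos by simp
  \<comment> \<open>The pipes leave tile \<open>(k, l)\<close> by the same edges as in
    \<open>D'\<close>, but through a bump, so their incoming edges are exchanged.\<close>
  have x: "on_pipe D (w b) (Ver k l)"
    using on_pipe_reach_back[OF x2, of "Ver k l"] kl pos by (simp add: strand_iff r_into_rtranclp)
  have y: "on_pipe D (w a) (Hor (k - 1) l)"
    using on_pipe_reach_back[OF y2, of "Hor (k - 1) l"] kl pos
    by (simp add: strand_iff r_into_rtranclp)
  obtain i j where cr: "crossing_at D (w b) (w a) (i, j)"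
    using crossing_at_exists[OF D ab] by auto
  note xc = crossing_at_reduced(1)[OF inj D ab cr] and yc = crossing_at_reduced(2)[OF inj D ab cr]
  have ij: "(i, j) \<in> D" "1 \<le> i" "1 \<le> j"
    using cr D by (auto simp: crossing_at_def RPD_def pipe_dream_def)
  have xc2: "on_pipe D (w b) (Hor i j)"
    using on_pipe_strand[OF xc, of "Hor i j"] ij by (simp add: strand_iff)
  have yc2: "on_pipe D (w a) (Ver i (j - 1))"
    using on_pipe_strand[OF yc, of "Ver i (j - 1)"] ij by (simp add: strand_iff)

  have earlier: "int l - int k < int j - int i"
  proof (rule ccontr)
    assume le: "\<not> int l - int k < int j - int i"
    have ne: "Hor (i - 1) j \<noteq> Ver k l" by simp
    \<comment> \<open>Two distinct edges of one pipe cannot share a level, which excludes equal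
      antidiagonals. A later crossing would lie where \<open>D\<close> and \<open>D'\<close> agree,
      hence be a second crossing in \<open>D'\<close>.\<close>
    have "level (Hor (i - 1) j) \<noteq> level (Ver k l)"
      using on_pipe_level_le[OF xc _ x] on_pipe_level_le[OF x _ xc] reach_eq_of_level ne
      by (metis order_refl)
    then have lt: "int j - int i + 1 \<le> int l - int k" using le ij by simp
    have "(strand D)\<^sup>*\<^sup>* (Hor k l) (Hor (i - 1) j)"
      using on_pipe_level_le[OF xc _ x2] lt ij by (simp add: of_nat_diff)
    then have X: "(strand D')\<^sup>*\<^sup>* (Hor k l) (Hor (i - 1) j)" "after_tile k l (Hor (i - 1) j)"
      using reach_after_tile[OF agree, of "Hor k l" "Hor (i - 1) j"] by simp_all
    have "(strand D)\<^sup>*\<^sup>* (Ver k (l - 1)) (Ver i j)"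
      using on_pipe_level_le[OF yc _ y2] lt pos by (simp add: of_nat_diff)
    then have Y: "(strand D')\<^sup>*\<^sup>* (Ver k (l - 1)) (Ver i j)"
      using reach_after_tile[OF agree, of "Ver k (l - 1)" "Ver i j"] pos by simp
    have "(i, j) \<in> D'" using agree[rule_format, of j i] X(2) ij by auto
    then have "crossing_at D' (w b) (w a) (i, j)"
      using on_pipe_reach[OF x'2 X(1)] on_pipe_reach[OF y'2 Y]
      by (simp add: crossing_at_def top_edge_def right_edge_def)
    then show False using crossing_at_unique[OF inj D' ab cr'] ij(1) kl(2) by blast
  qed

  have "(strand D)\<^sup>*\<^sup>* (Ver i (j - 1)) (Hor (k - 1) l)"
    using on_pipe_level_le[OF y _ yc2] earlier ij pos by (simp add: of_nat_diff)
  \<comment> \<open>Pipe \<open>w a\<close> runs from the crossing to the top edge of tile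
    \<open>(k, l)\<close>, whose row index is \<open>k - 1\<close>.\<close>
  then have ik: "i < k" using row_reach pos by fastforce
  have "(strand D)\<^sup>*\<^sup>* (Hor i j) (Ver k l)"
    using on_pipe_level_le[OF x _ xc2] earlier by simp
  then obtain i' j' where bump: "i < i'" "i' \<le> k" "1 \<le> j'" "(i', j') \<notin> D"
      "(strand D)\<^sup>*\<^sup>* (Hor i j) (Hor (i' - 1) j')"
    using reach_Hor_Ver_left_bump by blast
  let ?S = "{(p, q) \<in> left_bumps D (w b). p > i}"
  let ?S' = "{(p, q) \<in> left_bumps D' (w b). p > k}"
  have new: "(i', j') \<in> ?S"
    using bump on_pipe_reach[OF xc2 bump(5)] by (simp add: left_bumps_def top_edge_def)
  \<comment> \<open>Left bumps of \<open>D'\<close> below row \<open>k\<close> belong to the common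
    remainder, whereas the new bump has \<open>i' \<le> k\<close>.\<close>
  have "?S' \<subseteq> ?S - {(i', j')}"
  proof clarify
    fix p q assume pq: "(p, q) \<in> left_bumps D' (w b)" "k < p"
    then have pq': "1 \<le> q" "(p, q) \<notin> D'" "on_pipe D' (w b) (Hor (p - 1) q)"
      by (auto simp: left_bumps_def top_edge_def)
    have "(strand D')\<^sup>*\<^sup>* (Hor k l) (Hor (p - 1) q)"
    proof (rule ccontr)
      assume no: "\<not> ?thesis"
      then have "(strand D')\<^sup>*\<^sup>* (Hor (p - 1) q) (Hor k l)" "Hor (p - 1) q \<noteq> Hor k l"
        using on_pipe_linear[OF pq'(3) x'2] by auto
      then obtain g where "strand D' (Hor (p - 1) q) g" "(strand D')\<^sup>*\<^sup>* g (Hor k l)"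
        by (metis converse_rtranclpE)
      \<comment> \<open>Whichever way it turns, the next edge \<open>g\<close> has row
        \<open>p > k\<close>, too low to reach \<open>Hor k l\<close>.\<close>
      then show False using row_reach[of D' g "Hor k l"] pq(2)
        by (auto simp: strand_iff split: if_splits)
    qed
    then have after: "after_tile k l (Hor (p - 1) q)"
      using reach_after_tile[OF agree', of "Hor k l" "Hor (p - 1) q"] by simp
    then have "on_pipe D (w b) (Hor (p - 1) q)"
      using on_pipe_after_tile[OF agree' perm(2,1) ab1(2) pq'(3)] by simp
    moreover have "(p, q) \<notin> D" using agree[rule_format, of q p] after pq'(2) pq(2) by auto
    ultimately show "(p, q) \<in> ?S - {(i', j')}"
      using pq(2) pq'(1) ik bump(2) by (auto simp: left_bumps_def top_edge_def)
  qed
  then have "?S' \<subset> ?S" using new by blast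
  moreover have "finite ?S"
    by (rule finite_subset[OF _ finite_left_bumps[OF perm(1) ab1(2)]]) auto
  ultimately have "card ?S' < card ?S" by (simp add: psubset_card_mono)
  then show ?thesis
    using ab crossing_eq[OF inj D ab cr] crossing_eq[OF inj D' ab cr']
    by (intro exI[of _ a] exI[of _ b]) (simp add: tableau_entry_def)
qed

lemma first_difference:
  fixes A B :: "(nat \<times> nat) set"
  assumes "finite A" "finite B" "A \<noteq> B"
  obtains k l where "(k, l) \<in> A \<longleftrightarrow> (k, l) \<notin> B"
    "\<forall>i j. j < l \<or> j = l \<and> k < i \<longrightarrow> ((i, j) \<in> A \<longleftrightarrow> (i, j) \<in> B)"
proof -
  define S where "S = (A - B) \<union> (B - A)"
  define l where "l = Min (snd ` S)"
  define K where "K = {i. (i, l) \<in> S}"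
  have S: "finite S" "S \<noteq> {}" using assms by (auto simp: S_def)
  have l: "l \<in> snd ` S" "\<And>i j. (i, j) \<in> S \<Longrightarrow> l \<le> j"
    using S by (auto simp: l_def intro: Min_in) (metis Min_le finite_imageI image_eqI snd_conv)
  have "K \<subseteq> fst ` S" by (force simp: K_def)
  then have K: "finite K" "K \<noteq> {}" using S l(1) by (auto simp: K_def intro: finite_subset)
  have "Max K \<in> K" using K by simp
  then have "(Max K, l) \<in> A \<longleftrightarrow> (Max K, l) \<notin> B" by (auto simp: S_def K_def)
  moreover have "\<forall>i j. j < l \<or> j = l \<and> Max K < i \<longrightarrow> ((i, j) \<in> A \<longleftrightarrow> (i, j) \<in> B)"
  proof (intro allI impI)
    fix i j assume "j < l \<or> j = l \<and> Max K < i"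
    then have "(i, j) \<notin> S" using l(2)[of i j] Max_ge[OF K(1), of i] by (auto simp: K_def)
    then show "(i, j) \<in> A \<longleftrightarrow> (i, j) \<in> B" by (auto simp: S_def)
  qed
  ultimately show ?thesis by (rule that)
qed

lemma tableau_entry_cong:
  assumes "pd_tableau w D = pd_tableau w D'" "(a, b) \<in> Inv w"
  shows "tableau_entry D (w b) (w a) = tableau_entry D' (w b) (w a)"
proof -
  have "(a, w b) \<in> rothe_diagram w" using assms(2) by (auto simp: Inv_def rothe_diagram_def)
  then show ?thesis using fun_cong[OF assms(1), of "(a, w b)"] by (simp add: pd_tableau_def)
qed

theorem lemma5p6:
  fixes n :: nat and w :: "nat \<Rightarrow> nat" and D D' :: "(nat \<times> nat) set"
  assumes "w permutes {1..n}"
    and "D \<in> RPD w" and "D' \<in> RPD w"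
    and "pd_tableau w D = pd_tableau w D'"
  shows "D = D'"
proof (rule ccontr)
  have inj: "inj w" using assms(1) by (rule permutes_inj)
  assume "D \<noteq> D'"
  moreover have "finite D" "finite D'" using assms by (auto simp: RPD_def pipe_dream_def)
  ultimately obtain k l where kl: "(k, l) \<in> D \<longleftrightarrow> (k, l) \<notin> D'"
      and agree: "\<forall>i j. j < l \<or> j = l \<and> k < i \<longrightarrow> ((i, j) \<in> D \<longleftrightarrow> (i, j) \<in> D')"
    using first_difference by blast
  show False
  \<comment> \<open>The pipe dream with the cross at \<open>(k, l)\<close> takes the role of
    \<open>D'\<close> in \<open>tableau_entry_less\<close>.\<close>
  proof (cases "(k, l) \<in> D")
    case True
    then have "\<exists>a b. (a, b) \<in> Inv w \<and>
        tableau_entry D (w b) (w a) < tableau_entry D' (w b) (w a)"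
      using tableau_entry_less[OF inj assms(3,2), of k l] kl agree by blast
    then show ?thesis using tableau_entry_cong[OF assms(4)] by fastforce
  next
    case False
    then have "\<exists>a b. (a, b) \<in> Inv w \<and>
        tableau_entry D' (w b) (w a) < tableau_entry D (w b) (w a)"
      using tableau_entry_less[OF inj assms(2,3), of k l] kl agree by blast
    then show ?thesis using tableau_entry_cong[OF assms(4)] by fastforce
  qed
qed

end
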